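(* Let $\chi$ be the singleton umbra, $\beta$ the Bell umbra, $u$ the unity umbra and $u^{<-1>}$ the compositional inverse of $u$. Then $$\chi \equiv u^{<-1>}.\beta \equiv \beta.u^{<-1>},$$ $$\beta.\chi \equiv u \equiv \chi.\beta.$$
   Context: Umbral calculus: $R$ is a commutative integral domain whose quotient field has characteristic zero; $A$ is a set (alphabet) whose elements are called umbrae; $E:R[A]\to R$ is a linear functional (evaluation) with $E[1]=1$ and $E[\alpha^i\gamma^j\cdots\delta^k]=E[\alpha^i]E[\gamma^j]\cdots E[\delta^k]$ for distinct umbrae and nonnegative integers $i,j,\dots,k$. The alphabet contains the augmentation $\varepsilon$ with $E[\varepsilon^n]=\delta_{0,n}$ and the unity umbra $u$ with $E[u^n]=1$ for all $n\ge 0$. The moments of $\alpha$ are $a_n=E[\alpha^n]$; its generating function (g.f.) is the formal power series $f(t)=1+\sum_{n\ge1}a_n t^n/n!$. For $p,q\in R[A]$, $p\simeq q$ means $E[p]=E[q]$; $p\equiv q$ (similarity) means $p^n\simeq q^n$ for all $n\ge 0$. So two umbrae are similar iff they have the same g.f. The alphabet is assumed saturated, i.e. it contains sufficiently many distinct umbrae similar to any expression considered, so that the auxiliary umbrae below exist as umbrae; they are defined up to similarity by their g.f. Dot-product: if $\alpha$ has g.f. $f(t)$ and $\gamma$ has g.f. $g(t)$, then $\gamma.\alpha$ is an auxiliary umbra with g.f. $g[\log f(t)]$. Bell umbra $\beta$: the umbra with $E[\beta(\beta-1)\cdots(\beta-n+1)]=1$ for all $n\ge0$; its g.f. is $\exp(e^t-1)$.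 Singleton umbra $\chi$: $E[\chi^n]=\delta_{1,n}$ for $n\ge1$; its g.f. is $1+t$. Compositional inverse: $\alpha^{<-1>}$ is the umbra whose g.f., denoted $f^{-1}(t)$, satisfies $f^{-1}[f(t)-1]=f[f^{-1}(t)-1]=1+t$, where $f$ is the g.f. of $\alpha$. (For $\alpha=u$, $f(t)=e^t$.) *)

theory Defs
  imports
    "HOL-Library.Poly_Mapping"
    "HOL-Computational_Algebra.Fraction_Field"
    "HOL-Computational_Algebra.Formal_Power_Series"
begin

text \<open>
  The polynomial ring \<open>R[A]\<close> is the monoid algebra of the exponent vectors
  \<open>'a \<Rightarrow>\<^sub>0 nat\<close>, where \<open>'a\<close> is the alphabet \<open>A\<close> and
  \<open>'r\<close> is the domain \<open>R\<close>.
\<close>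

type_synonym ('a, 'r) umbral_poly = "('a \<Rightarrow>\<^sub>0 nat) \<Rightarrow>\<^sub>0 'r"

definition scalar :: "'r \<Rightarrow> ('a, 'r::comm_ring_1) umbral_poly" where
  "scalar c = Poly_Mapping.single 0 c"

definition umbra :: "'a \<Rightarrow> ('a, 'r::comm_ring_1) umbral_poly" where
  "umbra x = Poly_Mapping.single (Poly_Mapping.single x 1) 1"

text \<open>
  A domain has characteristic zero iff its quotient field has, so the standing
  assumption on \<open>R\<close> is the sort \<open>{idom, ring_char_0}\<close>.
\<close>

instance fract :: ("{idom, ring_char_0}") field_char_0
proof
  show "inj (of_nat :: nat \<Rightarrow> 'a fract)"
    by (auto intro!: injI simp: of_nat_fract eq_fract)
qed

text \<open>
  Saturation is read as: every sequence \<open>1, a\<^sub>1, a\<^sub>2, \<dots>\<close> in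
  \<open>R\<close> is the moment sequence of infinitely many umbrae.
\<close>

locale umbral_calculus =
  fixes E :: "('a, 'r::{idom, ring_char_0}) umbral_poly \<Rightarrow> 'r"
    and eps :: 'a
    and u :: 'a
  assumes eval_add: "E (p + q) = E p + E q"
    and eval_scalar: "E (scalar c * p) = c * E p"
    and eval_one: "E 1 = 1"
    and eval_uncorrelated:
      "finite X \<Longrightarrow> E (\<Prod>x\<in>X. umbra x ^ k x) = (\<Prod>x\<in>X. E (umbra x ^ k x))"
    and augmentation: "E (umbra eps ^ n) = (if n = 0 then 1 else 0)"
    and unity: "E (umbra u ^ n) = 1"
    and saturated: "a 0 = 1 \<Longrightarrow> infinite {x. \<forall>n. E (umbra x ^ n) = a n}"

definition similar ::
    "(('a, 'r::{idom, ring_char_0}) umbral_poly \<Rightarrow> 'r)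
      \<Rightarrow> ('a, 'r) umbral_poly \<Rightarrow> ('a, 'r) umbral_poly \<Rightarrow> bool" where
  "similar E p q \<longleftrightarrow> (\<forall>n. E (p ^ n) = E (q ^ n))"

definition gf ::
    "(('a, 'r::{idom, ring_char_0}) umbral_poly \<Rightarrow> 'r) \<Rightarrow> 'a \<Rightarrow> 'r fract fps" where
  "gf E x = Abs_fps (\<lambda>n. Fraction_Field.Fract (E (umbra x ^ n)) 1 / fact n)"

text \<open>
  \<open>fps_ln 1\<close> is the series of \<open>log (1 + t)\<close>; the composition below is
  meaningful for series with constant term \<open>1\<close>.
\<close>

definition fps_log :: "'k::field_char_0 fps \<Rightarrow> 'k fps" where
  "fps_log f = fps_ln 1 oo (f - 1)"

text \<open>
  An auxiliary umbra is determined only up to similarity by its generating function;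
  the operations \<open>dot\<close> and \<open>comp_inv\<close> choose a representative. It exists, by
  saturation, whenever the defining series has its moments in \<open>R\<close>.
\<close>

definition dot ::
    "(('a, 'r::{idom, ring_char_0}) umbral_poly \<Rightarrow> 'r) \<Rightarrow> 'a \<Rightarrow> 'a \<Rightarrow> 'a" where
  "dot E c a = (SOME d. gf E d = gf E c oo fps_log (gf E a))"

definition comp_inv ::
    "(('a, 'r::{idom, ring_char_0}) umbral_poly \<Rightarrow> 'r) \<Rightarrow> 'a \<Rightarrow> 'a" where
  "comp_inv E a = (SOME b. gf E b oo (gf E a - 1) = 1 + fps_X
                         \<and> gf E a oo (gf E b - 1) = 1 + fps_X)"

definition bell_umbra ::
    "(('a, 'r::{idom, ring_char_0}) umbral_poly \<Rightarrow> 'r) \<Rightarrow> 'a \<Rightarrow> bool" where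
  "bell_umbra E b \<longleftrightarrow> (\<forall>n. E (\<Prod>i<n. umbra b - of_nat i) = 1)"

definition singleton_umbra ::
    "(('a, 'r::{idom, ring_char_0}) umbral_poly \<Rightarrow> 'r) \<Rightarrow> 'a \<Rightarrow> bool" where
  "singleton_umbra E c \<longleftrightarrow> (\<forall>n\<ge>1. E (umbra c ^ n) = (if n = 1 then 1 else 0))"

end

theory Submission
  imports Defs
begin

text \<open>
  Everything is computed on generating functions, which determine umbrae up to similarity. With
  \<open>L = log (1 + t)\<close> and \<open>M = e\<^sup>t - 1\<close> mutually inverse under composition, the generating
  functions of \<open>\<chi>\<close>, of \<open>u\<close> and of the compositional inverse of \<open>u\<close> are
  \<open>1 + t\<close>, \<open>e\<^sup>t = 1 + M\<close> and \<open>1 + L\<close>, so all dot-products collapse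
  once the Bell umbra is known to have generating function \<open>e\<^sup>t \<circ> M\<close>.
  For the latter, the functional satisfies \<open>E[\<beta> p(\<beta> - 1)] = E[p(\<beta>)]\<close> on falling factorials,
  hence on powers, and this says that the generating function \<open>g\<close> solves \<open>g = e\<^sup>-\<^sup>t g'\<close>.
\<close>

unbundle fps_syntax

lemma fps_ln_compose_exp:
  "fps_ln (1::'k::field_char_0) oo (fps_exp 1 - 1) = fps_X"
  by (simp add: fps_ln_fps_exp_inv fps_inv)

lemma fps_exp_compose_ln:
  "(fps_exp (1::'k::field_char_0) - 1) oo fps_ln 1 = fps_X"
  by (simp add: fps_ln_fps_exp_inv fps_inv_right)

lemma fps_one_plus_compose: "(1 + f) oo g = 1 + (f oo (g :: 'k::comm_ring_1 fps))"
  by (simp add: fps_compose_add_distrib)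

text \<open>Both \<open>g\<close> and the composite solve \<open>y' = e^t y\<close>, so their
  quotient has derivative zero; comparing constant terms makes it 1.\<close>

lemma fps_exp_unique_compose_ODE:
  fixes g :: "'k::field_char_0 fps"
  assumes "g $ 0 = 1" and "g = fps_exp (-1) * fps_deriv g"
  shows "g = fps_exp 1 oo (fps_exp 1 - 1)"
proof -
  let ?b = "fps_exp 1 oo (fps_exp 1 - 1) :: 'k fps"
  have binv: "inverse ?b * ?b = 1"
    by (intro inverse_mult_eq_1) simp
  have db: "fps_deriv ?b = fps_exp 1 * ?b"
    by (simp add: fps_compose_deriv mult.commute)
  have "fps_exp 1 * g = fps_exp 1 * fps_exp (-1) * fps_deriv g"
    using assms(2) by (simp add: mult.assoc)
  also have "fps_exp 1 * fps_exp (-1) = (1::'k fps)"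
    by (simp flip: fps_exp_add_mult)
  finally have dg: "fps_deriv g = fps_exp 1 * g" by simp
  have "fps_deriv (g * inverse ?b) = 0"
    using binv by (simp add: fps_inverse_deriv dg db power2_eq_square mult.commute)
  then have "g * inverse ?b = fps_const ((g * inverse ?b) $ 0)"
    using fps_deriv_eq_0_iff by blast
  also have "\<dots> = 1" using assms(1) by simp
  finally have "g * (inverse ?b * ?b) = ?b" by (simp flip: mult.assoc)
  with binv show ?thesis by simp
qed

lemma Fract_add_1:
  "Fraction_Field.Fract (a + b) 1 = Fraction_Field.Fract a 1 + Fraction_Field.Fract b 1"
  by simp

lemma Fract_sum_1: "Fraction_Field.Fract (sum f A) 1 = (\<Sum>x\<in>A. Fraction_Field.Fract (f x) 1)"
  by (induction A rule: infinite_finite_induct)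
    (simp_all add: Zero_fract_def Fract_add_1 del: add_fract)

lemma Fract_1_0_over_1: "Fraction_Field.Fract 1 1 = 1" "Fraction_Field.Fract 0 1 = 0"
  by (simp_all add: One_fract_def Zero_fract_def)

lemma gf_nth: "gf E x $ n = Fraction_Field.Fract (E (umbra x ^ n)) 1 / fact n"
  by (simp add: gf_def)

text \<open>The domain embeds in its quotient field and factorials are nonzero there, so the
  coefficients recover the moments.\<close>

lemma similar_iff_gf: "similar E (umbra x) (umbra y) \<longleftrightarrow> gf E x = gf E y"
  by (simp add: similar_def fps_eq_iff gf_nth eq_fract)

context umbral_calculus
begin

lemma eval_zero: "E 0 = 0"
  using eval_add[of 0 0] by simp

lemma eval_minus: "E (- p) = - E p"
  using eval_add[of p "- p"] by (simp add: eval_zero eq_neg_iff_add_eq_0 add.commute)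

lemma eval_sum: "E (sum f I) = (\<Sum>i\<in>I. E (f i))"
  by (induction I rule: infinite_finite_induct) (simp_all add: eval_zero eval_add)

lemma eval_of_nat_mult: "E (of_nat m * p) = of_nat m * E p"
  by (induction m) (simp_all add: eval_zero eval_add distrib_right)

lemma gf_unity: "gf E u = fps_exp 1"
  by (simp add: fps_eq_iff gf_nth unity Fract_1_0_over_1)

lemma gf_singleton:
  assumes "singleton_umbra E c"
  shows "gf E c = 1 + fps_X"
proof (rule fps_ext)
  fix n
  show "gf E c $ n = (1 + fps_X) $ n"
    using assms by (cases n) (auto simp: gf_nth singleton_umbra_def eval_one Fract_1_0_over_1 simp del: power_Suc)
qed

text \<open>\<open>E\<close> is 1 on every falling factorial, and the one of order
  \<open>k + 1\<close> in \<open>b\<close> is \<open>b\<close> times the one of order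
  \<open>k\<close> in \<open>b - 1\<close>. This settles falling factorials; the induction carries
  it over to powers.\<close>

lemma eval_bell_shift:
  assumes "bell_umbra E b"
  shows "E (umbra b * (umbra b - 1) ^ n) = E (umbra b ^ n)"
proof -
  define x where "x = (umbra b :: ('a, 'r) umbral_poly)"
  define ff where "ff k = (\<Prod>i<k. x - of_nat i)" for k
  define sf where "sf k = (\<Prod>i<k. x - 1 - of_nat i)" for k
  have ff: "ff (Suc k) = x * sf k" for k
    by (simp add: ff_def sf_def prod.lessThan_Suc_shift algebra_simps del: prod.lessThan_Suc)
  \<comment> \<open>The falling factorial of arbitrary order \<open>k\<close> strengthens the claim
    so that the induction on \<open>n\<close> closes; \<open>k = 0\<close> gives the lemma.\<close>
  have "E (x * sf k * (x - 1) ^ n) = E (ff k * x ^ n)" for k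
  proof (induction n arbitrary: k)
    case 0
    show ?case
      using assms by (simp flip: ff) (simp add: ff_def x_def bell_umbra_def del: prod.lessThan_Suc)
  next
    case (Suc n)
    \<comment> \<open>Writing \<open>x - 1 = (x - 1 - k) + k\<close> here and
      \<open>x = (x - k) + k\<close> below gives both sides the same recursion in \<open>n\<close>
      and \<open>k\<close>.\<close>
    have "x * sf k * (x - 1) ^ Suc n
        = x * sf (Suc k) * (x - 1) ^ n + of_nat k * (x * sf k * (x - 1) ^ n)"
      by (simp add: sf_def algebra_simps)
    moreover have "ff k * x ^ Suc n = ff (Suc k) * x ^ n + of_nat k * (ff k * x ^ n)"
      by (simp add: ff_def algebra_simps)
    ultimately show ?case
      by (simp only: eval_add eval_of_nat_mult Suc.IH)
  qed
  from this[of 0] show ?thesis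
    by (simp add: ff_def sf_def x_def)
qed

text \<open>Expanding \<open>b (b - 1)^n\<close> binomially turns the shift identity into a moment
  recursion, which is \<open>g = e^(-t) g'\<close> read coefficientwise.\<close>

lemma gf_bell:
  assumes "bell_umbra E b"
  shows "gf E b = fps_exp 1 oo (fps_exp 1 - 1)"
proof (rule fps_exp_unique_compose_ODE)
  show "gf E b $ 0 = 1"
    by (simp add: gf_nth eval_one Fract_1_0_over_1)
  define m where "m n = E (umbra b ^ n)" for n
  have rec: "m n = (\<Sum>k\<le>n. of_nat (n choose k) * ((-1) ^ (n - k) * m (Suc k)))" for n
  proof -
    have "m n = E (umbra b * (umbra b + (-1)) ^ n)"
      using eval_bell_shift[OF assms, of n] by (simp add: m_def)
    also have "umbra b * (umbra b + (-1)) ^ n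
        = (\<Sum>k\<le>n. of_nat (n choose k) * ((-1) ^ (n - k) * umbra b ^ Suc k) :: ('a, 'r) umbral_poly)"
      unfolding binomial_ring by (simp add: sum_distrib_left mult_ac)
    also have "E \<dots> = (\<Sum>k\<le>n. of_nat (n choose k) * ((-1) ^ (n - k) * m (Suc k)))"
      unfolding eval_sum eval_of_nat_mult
      by (intro sum.cong refl) (simp add: m_def minus_one_power_iff eval_minus)
    finally show ?thesis .
  qed
  show "gf E b = fps_exp (-1) * fps_deriv (gf E b)"
  proof (rule fps_ext)
    fix n
    have "gf E b $ n = (\<Sum>k\<le>n. of_nat (n choose k) *
        ((-1) ^ (n - k) * Fraction_Field.Fract (m (Suc k)) 1)) / fact n"
      unfolding gf_nth m_def[symmetric] rec[of n] Fract_sum_1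
      by (intro arg_cong2[where f = "(/)"] sum.cong refl)
        (simp add: of_nat_fract minus_one_power_iff)
    also have "\<dots> = (\<Sum>k\<le>n. fps_deriv (gf E b) $ k * fps_exp (-1) $ (n - k))"
      unfolding sum_divide_distrib
    proof (intro sum.cong refl)
      fix k assume "k \<in> {..n}"
      then have "of_nat (n choose k) = (fact n / (fact k * fact (n - k)) :: 'r fract)"
        by (simp add: binomial_fact)
      then show "of_nat (n choose k) *
          ((-1) ^ (n - k) * Fraction_Field.Fract (m (Suc k)) 1) / fact n
          = fps_deriv (gf E b) $ k * fps_exp (-1) $ (n - k)"
        by (simp add: gf_nth m_def field_simps del: of_nat_Suc)
    qed
    also have "\<dots> = (fps_deriv (gf E b) * fps_exp (-1)) $ n"
      by (simp add: fps_mult_nth atLeast0AtMost)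
    finally show "gf E b $ n = (fps_exp (-1) * fps_deriv (gf E b)) $ n"
      by (simp add: mult.commute)
  qed
qed

text \<open>The moments of \<open>1 + log (1 + t)\<close> are signed factorials, hence lie in the
  domain, so saturation applies. The witness shows that the choice in \<open>comp_inv E u\<close>
  succeeds.\<close>

lemma ex_gf_one_plus_ln: "\<exists>x. gf E x = 1 + fps_ln 1"
proof -
  define a where "a n = (if n = 0 then 1 else (-1) ^ (n - 1) * fact (n - 1) :: 'r)" for n
  have "infinite {x. \<forall>n. E (umbra x ^ n) = a n}"
    by (rule saturated) (simp add: a_def)
  then obtain x where x: "E (umbra x ^ n) = a n" for n
    using not_finite_existsD by blast
  have fact_Fract: "Fraction_Field.Fract (fact k) 1 = (fact k :: 'r fract)" for k
    using of_nat_fract[of "fact k", where 'a = 'r] by simp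
  have "gf E x $ n = (1 + fps_ln 1) $ n" for n
    by (cases n) (simp_all add: gf_nth x[unfolded a_def] fps_ln_def Fract_1_0_over_1 fact_Fract
        minus_one_power_iff field_simps del: of_nat_Suc power_Suc power_0 minus_fract
        flip: minus_fract)
  then have "gf E x = 1 + fps_ln 1" by (rule fps_ext)
  then show ?thesis ..
qed

lemma gf_comp_inv_unity: "gf E (comp_inv E u) = 1 + fps_ln 1"
proof -
  let ?L = "fps_ln 1 :: 'r fract fps" and ?M = "fps_exp 1 - 1 :: 'r fract fps"
  let ?P = "\<lambda>b. gf E b oo (gf E u - 1) = 1 + fps_X \<and> gf E u oo (gf E b - 1) = 1 + fps_X"
  obtain x where "gf E x = 1 + ?L" using ex_gf_one_plus_ln by blast
  moreover have "fps_exp 1 oo ?L = 1 + fps_X"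
    using fps_one_plus_compose[of ?M ?L] by (simp add: fps_exp_compose_ln)
  ultimately have "?P x"
    by (simp add: gf_unity fps_one_plus_compose fps_ln_compose_exp)
  then have "?P (comp_inv E u)"
    unfolding comp_inv_def by (rule someI)
  \<comment> \<open>Composing with \<open>?L\<close> cancels \<open>?M\<close>, so every admissible
    choice has the same generating function.\<close>
  then have "(gf E (comp_inv E u) oo ?M) oo ?L = 1 + ?L"
    by (simp add: gf_unity fps_one_plus_compose)
  then show ?thesis
    by (simp add: fps_exp_compose_ln flip: fps_compose_assoc)
qed

text \<open>An umbra already known to have the required series makes the choice in
  \<open>dot\<close> succeed; below, \<open>\<chi>\<close> and \<open>u\<close> serve as such
  witnesses.\<close>

lemma gf_dot:
  assumes "gf E d = gf E c oo fps_log (gf E a)"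
  shows "gf E (dot E c a) = gf E d"
  using someI[of "\<lambda>d. gf E d = gf E c oo fps_log (gf E a)", OF assms] assms
  by (simp add: dot_def)

end

theorem proposition3p3:
  fixes E :: "('a, 'r::{idom, ring_char_0}) umbral_poly \<Rightarrow> 'r"
    and eps u \<chi> \<beta> :: 'a
  assumes "umbral_calculus E eps u"
    and "singleton_umbra E \<chi>"
    and "bell_umbra E \<beta>"
  shows "similar E (umbra \<chi>) (umbra (dot E (comp_inv E u) \<beta>))
       \<and> similar E (umbra (dot E (comp_inv E u) \<beta>)) (umbra (dot E \<beta> (comp_inv E u)))
       \<and> similar E (umbra (dot E \<beta> \<chi>)) (umbra u)
       \<and> similar E (umbra u) (umbra (dot E \<chi> \<beta>))"
proof -
  interpret umbral_calculus E eps u by fact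
  let ?L = "fps_ln 1 :: 'r fract fps" and ?M = "fps_exp 1 - 1 :: 'r fract fps"
  let ?v = "comp_inv E u"
  have \<chi>: "gf E \<chi> = 1 + fps_X" by (rule gf_singleton) fact
  have \<beta>: "gf E \<beta> = 1 + (?M oo ?M)"
    by (simp add: gf_bell[OF assms(3)] fps_compose_sub_distrib)
  have log_\<beta>: "fps_log (gf E \<beta>) = ?M"
    by (simp add: fps_log_def \<beta> fps_compose_assoc fps_ln_compose_exp)
  have "gf E (dot E ?v \<beta>) = gf E \<chi>"
    by (rule gf_dot)
      (simp add: log_\<beta> gf_comp_inv_unity \<chi> fps_one_plus_compose fps_ln_compose_exp)
  moreover have "gf E (dot E \<beta> ?v) = gf E \<chi>"
  proof (rule gf_dot)
    \<comment> \<open>\<open>?L oo ?L\<close> is the logarithm of \<open>1 + ?L\<close>.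
      Rebracketing brings the inverse pair \<open>?M oo ?L\<close> together, twice in
      succession.\<close>
    have "(?M oo ?M) oo (?L oo ?L) = ?M oo ((?M oo ?L) oo ?L)"
      by (simp add: fps_compose_assoc)
    then show "gf E \<chi> = gf E \<beta> oo fps_log (gf E ?v)"
      by (simp add: \<beta> \<chi> fps_log_def gf_comp_inv_unity fps_one_plus_compose fps_exp_compose_ln)
  qed
  moreover have "gf E (dot E \<beta> \<chi>) = gf E u"
  proof (rule gf_dot)
    have "(?M oo ?M) oo ?L = ?M"
      by (simp add: fps_exp_compose_ln flip: fps_compose_assoc)
    then show "gf E u = gf E \<beta> oo fps_log (gf E \<chi>)"
      by (simp add: \<beta> \<chi> fps_log_def gf_unity fps_one_plus_compose)
  qed
  moreover have "gf E (dot E \<chi> \<beta>) = gf E u"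
    by (rule gf_dot) (simp add: log_\<beta> \<chi> gf_unity fps_one_plus_compose)
  ultimately show ?thesis
    by (simp add: similar_iff_gf)
qed

end
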